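(* Let $k\ge 3$. For each of the $k$ complex numbers $a$ with $a^k=-1$, let $$\beta=(\beta_0,\dots,\beta_k)=(a^{k-1},1,0,\dots,0),\qquad \alpha=(\alpha_0,\dots,\alpha_k)=\Big(\frac{a^{k-2}}{1-a},\,0,\,a^{k-2},\,a^{k-3},\dots,a^2,\,a,\,1\Big),$$ that is, $\alpha_0=a^{k-2}/(1-a)$, $\alpha_1=0$ and $\alpha_j=a^{k-j}$ for $2\le j\le k$. Then the $k$-step linear fractional recurrence $$x_{n+k+1}=\frac{\alpha_0+\alpha_1x_{n+1}+\cdots+\alpha_kx_{n+k}}{\beta_0+\beta_1x_{n+1}+\cdots+\beta_kx_{n+k}}$$ is periodic with period $4k$. The $k$ choices of $a$ give $k$ different recurrences.
   Context: The recurrence is associated with the birational map $$f_{\alpha,\beta}(x_1,\dots,x_k)=\Big(x_2,\dots,x_k,\frac{\alpha_0+\alpha_1x_1+\cdots+\alpha_kx_k}{\beta_0+\beta_1x_1+\cdots+\beta_kx_k}\Big)$$ of complex $k$-dimensional space. The recurrence is periodic if the sequence $\{x_j\}$ is periodic for every starting point $(x_1,\dots,x_k)\in\mathbb{C}^k$ for which all terms are defined (no denominator vanishes); equivalently, $f_{\alpha,\beta}^{p}=\mathrm{id}$ as a rational map for some $p\ge1$. The period is the least such $p$. *)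

theory Defs
  imports Complex_Main "HOL-Library.Poly_Mapping" "HOL-Computational_Algebra.Fraction_Field"
begin

text \<open>Coefficients \<open>c\<^sub>0, \<dots>, c\<^sub>k\<close> are functions on \<open>nat\<close>; only the values at \<open>0, \<dots>, k\<close> matter.\<close>

definition affine_form :: "nat \<Rightarrow> (nat \<Rightarrow> 'a::field) \<Rightarrow> (nat \<Rightarrow> 'a) \<Rightarrow> 'a" where
  "affine_form k c x = c 0 + (\<Sum>j=1..k. c j * x j)"


subsection \<open>The recurrence on complex sequences\<close>

text \<open>
  A sequence is \<open>x 1, x 2, \<dots>\<close>; the value \<open>x 0\<close> is unused. The predicate below says that
  the starting point \<open>(x 1, \<dots>, x k)\<close> never meets a vanishing denominator and
  that \<open>x\<close> is the sequence it generates.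
\<close>

definition lfr_sequence ::
    "nat \<Rightarrow> (nat \<Rightarrow> complex) \<Rightarrow> (nat \<Rightarrow> complex) \<Rightarrow> (nat \<Rightarrow> complex) \<Rightarrow> bool" where
  "lfr_sequence k \<alpha> \<beta> x \<longleftrightarrow>
     (\<forall>n. affine_form k \<beta> (\<lambda>j. x (n + j)) \<noteq> 0 \<and>
          x (n + k + 1) =
            affine_form k \<alpha> (\<lambda>j. x (n + j)) / affine_form k \<beta> (\<lambda>j. x (n + j)))"

definition lfr_periodic :: "nat \<Rightarrow> (nat \<Rightarrow> complex) \<Rightarrow> (nat \<Rightarrow> complex) \<Rightarrow> bool" where
  "lfr_periodic k \<alpha> \<beta> \<longleftrightarrow>
     (\<forall>x. lfr_sequence k \<alpha> \<beta> x \<longrightarrow> (\<exists>p\<ge>1. \<forall>n\<ge>1. x (n + p) = x n))"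


subsection \<open>The associated rational map\<close>

text \<open>
  Rational functions over \<open>\<complex>\<close> in the indeterminates \<open>X\<^sub>0, X\<^sub>1, \<dots>\<close>: the fraction field of the
  polynomial ring, a monomial being its finitely supported exponent function. A rational self-map
  of \<open>\<complex>\<^sup>k\<close> is given by its list of \<open>k\<close> components in \<open>\<complex>(X\<^sub>1, \<dots>, X\<^sub>k)\<close>; equality
  of such lists is equality of rational maps.
\<close>

type_synonym ratfun = "((nat \<Rightarrow>\<^sub>0 nat) \<Rightarrow>\<^sub>0 complex) fract"

definition rf_const :: "complex \<Rightarrow> ratfun" where
  "rf_const c = Fract (Poly_Mapping.single 0 c) 1"

definition rf_var :: "nat \<Rightarrow> ratfun" where
  "rf_var i = Fract (Poly_Mapping.single (Poly_Mapping.single i 1) 1) 1"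

definition rat_id :: "nat \<Rightarrow> ratfun list" where
  "rat_id k = map rf_var [1..<k+1]"

text \<open>
  The composition \<open>f\<^bsub>\<alpha>,\<beta>\<^esub> \<circ> g\<close> for a rational map \<open>g\<close> with component list \<open>g\<close> (so \<open>g ! (j - 1)\<close>
  is its \<open>j\<close>-th component). It is undefined if the denominator of \<open>f\<^bsub>\<alpha>,\<beta>\<^esub>\<close> becomes the zero rational function after
  substituting \<open>g\<close>.
\<close>

definition lfr_compose ::
    "nat \<Rightarrow> (nat \<Rightarrow> complex) \<Rightarrow> (nat \<Rightarrow> complex) \<Rightarrow> ratfun list \<Rightarrow> ratfun list option" where
  "lfr_compose k \<alpha> \<beta> g =
     (let N = affine_form k (\<lambda>j. rf_const (\<alpha> j)) (\<lambda>j. g ! (j - 1));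
          D = affine_form k (\<lambda>j. rf_const (\<beta> j)) (\<lambda>j. g ! (j - 1))
      in if D = 0 then None else Some (tl g @ [N / D]))"

definition lfr_map :: "nat \<Rightarrow> (nat \<Rightarrow> complex) \<Rightarrow> (nat \<Rightarrow> complex) \<Rightarrow> ratfun list option" where
  "lfr_map k \<alpha> \<beta> = lfr_compose k \<alpha> \<beta> (rat_id k)"

primrec lfr_power ::
    "nat \<Rightarrow> (nat \<Rightarrow> complex) \<Rightarrow> (nat \<Rightarrow> complex) \<Rightarrow> nat \<Rightarrow> ratfun list option" where
  "lfr_power k \<alpha> \<beta> 0 = Some (rat_id k)"
| "lfr_power k \<alpha> \<beta> (Suc p) = Option.bind (lfr_power k \<alpha> \<beta> p) (lfr_compose k \<alpha> \<beta>)"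

definition lfr_has_period :: "nat \<Rightarrow> (nat \<Rightarrow> complex) \<Rightarrow> (nat \<Rightarrow> complex) \<Rightarrow> nat \<Rightarrow> bool" where
  "lfr_has_period k \<alpha> \<beta> p \<longleftrightarrow>
     p \<ge> 1 \<and> lfr_power k \<alpha> \<beta> p = Some (rat_id k) \<and>
     (\<forall>q. 1 \<le> q \<and> q < p \<longrightarrow> lfr_power k \<alpha> \<beta> q \<noteq> Some (rat_id k))"


subsection \<open>The coefficients\<close>

definition alpha_coeff :: "nat \<Rightarrow> complex \<Rightarrow> nat \<Rightarrow> complex" where
  "alpha_coeff k a j =
     (if j = 0 then a ^ (k - 2) / (1 - a)
      else if j = 1 then 0
      else a ^ (k - j))"

definition beta_coeff :: "nat \<Rightarrow> complex \<Rightarrow> nat \<Rightarrow> complex" where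
  "beta_coeff k a j = (if j = 0 then a ^ (k - 1) else if j = 1 then 1 else 0)"

end

theory Submission
  imports Defs
begin

text \<open>
  Put \<open>u\<^sub>n = a x\<^sub>n\<close>. Eliminating the sum from two consecutive instances of the recurrence gives
  \<open>(u\<^bsub>m+k+1\<^esub> - 1) (u\<^bsub>m+1\<^esub> - 1) = a u\<^bsub>m+k\<^esub> u\<^sub>m\<close>, that is \<open>r\<^sub>m r\<^bsub>m+k\<^esub> = a\<close> for \<open>r\<^sub>m = (u\<^bsub>m+1\<^esub> - 1) / u\<^sub>m\<close>.
  Hence \<open>r\<close> has period \<open>2k\<close>, and \<open>u\<^bsub>m+2k\<^esub>\<close> is an affine function of \<open>u\<^sub>m\<close> with slope
  \<open>a\<^sup>k = -1\<close> and \<open>2k\<close>-periodic intercept, so \<open>u\<close> has period \<open>4k\<close>. This works over any field, in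
  particular for the sequence of rational functions generated by the indeterminates; its denominators
  do not vanish because they do not vanish at a fixed point.

  If \<open>q < 4k\<close> were a period, then \<open>r\<close> would have period \<open>gcd q (2k)\<close>, which is \<open>2k\<close> or at most \<open>k\<close>.
  Both cases are refuted by evaluating the rational functions at a generic point that differs from a
  fixed point in the last coordinate only.
\<close>

subsection \<open>Evaluation of rational functions at a point\<close>

definition mon_eval :: "('i \<Rightarrow> 'a::comm_semiring_1) \<Rightarrow> ('i \<Rightarrow>\<^sub>0 nat) \<Rightarrow> 'a" where
  "mon_eval P m = (\<Prod>i\<in>Poly_Mapping.keys m. P i ^ Poly_Mapping.lookup m i)"

definition pm_eval ::
    "('i \<Rightarrow> 'a::comm_semiring_1) \<Rightarrow> (('i \<Rightarrow>\<^sub>0 nat) \<Rightarrow>\<^sub>0 'a) \<Rightarrow> 'a" where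
  "pm_eval P p = (\<Sum>m\<in>Poly_Mapping.keys p. Poly_Mapping.lookup p m * mon_eval P m)"

lemma mon_eval_superset:
  assumes "finite A" "Poly_Mapping.keys m \<subseteq> A"
  shows "mon_eval P m = (\<Prod>i\<in>A. P i ^ Poly_Mapping.lookup m i)"
  unfolding mon_eval_def
  by (rule prod.mono_neutral_left) (use assms in \<open>auto simp: in_keys_iff\<close>)

lemma mon_eval_add: "mon_eval P (m + n) = mon_eval P m * mon_eval P n"
proof -
  let ?A = "Poly_Mapping.keys m \<union> Poly_Mapping.keys n"
  have "mon_eval P (m + n) = (\<Prod>i\<in>?A. P i ^ Poly_Mapping.lookup (m + n) i)"
    using keys_add[of m n] by (intro mon_eval_superset) auto
  also have "\<dots> = (\<Prod>i\<in>?A. P i ^ Poly_Mapping.lookup m i) * (\<Prod>i\<in>?A. P i ^ Poly_Mapping.lookup n i)"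
    by (simp add: lookup_add power_add prod.distrib)
  also have "\<dots> = mon_eval P m * mon_eval P n"
    by (simp add: mon_eval_superset[of ?A])
  finally show ?thesis .
qed

lemma pm_eval_add: "pm_eval P (p + q) = pm_eval P p + pm_eval P q"
  unfolding pm_eval_def by (rule setsum_keys_plus_distrib) (simp_all add: distrib_right)

lemma pm_eval_0 [simp]: "pm_eval P 0 = 0"
  by (simp add: pm_eval_def)

lemma pm_eval_single: "pm_eval P (Poly_Mapping.single m c) = c * mon_eval P m"
  by (simp add: pm_eval_def)

lemma pm_eval_const [simp]: "pm_eval P (Poly_Mapping.single 0 c) = c"
  by (simp add: pm_eval_single mon_eval_def)

lemma pm_eval_1 [simp]: "pm_eval P 1 = 1"
  using pm_eval_const[of P 1] by simp

lemma pm_eval_var [simp]: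
  "pm_eval P (Poly_Mapping.single (Poly_Mapping.single i 1) 1) = P i"
  by (simp add: pm_eval_single mon_eval_def)

text \<open>Updating outside the support amounts to adding a one-term polynomial, so additivity of
  evaluation alone handles the induction step.\<close>

lemma pm_induct [case_names zero add]:
  fixes p :: "'b \<Rightarrow>\<^sub>0 'a::comm_monoid_add"
  assumes "Q 0" and "\<And>p m c. Q p \<Longrightarrow> Q (Poly_Mapping.single m c + p)"
  shows "Q p"
proof (induction p rule: update_induct)
  case const
  show ?case by (fact assms(1))
next
  case (update p m c)
  have "Poly_Mapping.update m c p = Poly_Mapping.single m c + p"
    using update(1)
    by (intro poly_mapping_eqI) (auto simp: lookup_update lookup_add lookup_single when_def in_keys_iff)
  then show ?case using assms(2) update by simp
qed

lemma pm_eval_mult: "pm_eval P (p * q) = pm_eval P p * pm_eval P q"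
proof (induction p rule: pm_induct)
  case zero
  show ?case by simp
next
  case (add p m c)
  have "pm_eval P (Poly_Mapping.single m c * q) = c * mon_eval P m * pm_eval P q"
    by (induction q rule: pm_induct)
      (simp_all add: distrib_left mult_single pm_eval_add pm_eval_single mon_eval_add algebra_simps)
  with add show ?case
    by (simp add: distrib_right pm_eval_add pm_eval_single)
qed

section \<open>Values of fractions of polynomials\<close>

text \<open>A relation rather than a function: evaluation is partial, and one representative with
  nonvanishing denominator suffices, whatever the other representatives do at
  \<open>P\<close>.\<close>

definition has_value :: "(nat \<Rightarrow> complex) \<Rightarrow> ratfun \<Rightarrow> complex \<Rightarrow> bool" where
  "has_value P r c \<longleftrightarrow>
     (\<exists>p q. r = Fract p q \<and> pm_eval P q \<noteq> 0 \<and> c = pm_eval P p / pm_eval P q)"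

text \<open>Evaluating the cross-multiplied identity of two representatives gives the claim. It lets
  numbers refute identities: a fraction with a nonzero value is nonzero, and equal fractions have
  equal values.\<close>

lemma has_value_unique:
  assumes "has_value P r c" "has_value P r d"
  shows "c = d"
proof -
  obtain p q where pq: "r = Fract p q" "pm_eval P q \<noteq> 0" "c = pm_eval P p / pm_eval P q"
    using assms(1) by (auto simp: has_value_def)
  obtain p' q' where pq': "r = Fract p' q'" "pm_eval P q' \<noteq> 0" "d = pm_eval P p' / pm_eval P q'"
    using assms(2) by (auto simp: has_value_def)
  have "q \<noteq> 0" "q' \<noteq> 0" using pq pq' by auto
  with pq(1) pq'(1) have "p * q' = p' * q" by (simp add: eq_fract)
  then have "pm_eval P p * pm_eval P q' = pm_eval P p' * pm_eval P q"
    by (metis pm_eval_mult)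
  with pq pq' show ?thesis by (simp add: frac_eq_eq)
qed

lemma has_value_const: "has_value P (rf_const c) c"
  unfolding has_value_def rf_const_def
  by (rule exI[of _ "Poly_Mapping.single 0 c"], rule exI[of _ 1]) simp

lemma has_value_0: "has_value P 0 0"
  unfolding has_value_def Zero_fract_def by (rule exI[of _ 0], rule exI[of _ 1]) simp

lemma has_value_1: "has_value P 1 1"
  unfolding has_value_def One_fract_def by (rule exI[of _ 1], rule exI[of _ 1]) simp

lemma has_value_var: "has_value P (rf_var i) (P i)"
  unfolding has_value_def rf_var_def
  by (rule exI[of _ "Poly_Mapping.single (Poly_Mapping.single i 1) 1"], rule exI[of _ 1])
    (simp del: One_nat_def)

lemma has_value_add:
  assumes "has_value P r c" "has_value P s d"
  shows "has_value P (r + s) (c + d)"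
proof -
  obtain p q where pq: "r = Fract p q" "pm_eval P q \<noteq> 0" "c = pm_eval P p / pm_eval P q"
    using assms(1) by (auto simp: has_value_def)
  obtain p' q' where pq': "s = Fract p' q'" "pm_eval P q' \<noteq> 0" "d = pm_eval P p' / pm_eval P q'"
    using assms(2) by (auto simp: has_value_def)
  have "q \<noteq> 0" "q' \<noteq> 0" using pq pq' by auto
  then have "r + s = Fract (p * q' + p' * q) (q * q')" using pq pq' by simp
  moreover have "c + d = pm_eval P (p * q' + p' * q) / pm_eval P (q * q')"
    using pq pq' by (simp add: pm_eval_add pm_eval_mult add_frac_eq)
  ultimately show ?thesis
    unfolding has_value_def using pq pq' by (metis pm_eval_mult mult_eq_0_iff)
qed

lemma has_value_mult:
  assumes "has_value P r c" "has_value P s d"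
  shows "has_value P (r * s) (c * d)"
proof -
  obtain p q where pq: "r = Fract p q" "pm_eval P q \<noteq> 0" "c = pm_eval P p / pm_eval P q"
    using assms(1) by (auto simp: has_value_def)
  obtain p' q' where pq': "s = Fract p' q'" "pm_eval P q' \<noteq> 0" "d = pm_eval P p' / pm_eval P q'"
    using assms(2) by (auto simp: has_value_def)
  have "r * s = Fract (p * p') (q * q')" using pq pq' by simp
  moreover have "c * d = pm_eval P (p * p') / pm_eval P (q * q')"
    using pq pq' by (simp add: pm_eval_mult)
  ultimately show ?thesis
    unfolding has_value_def using pq pq' by (metis pm_eval_mult mult_eq_0_iff)
qed

lemma has_value_inverse:
  assumes "has_value P r c" "c \<noteq> 0"
  shows "has_value P (inverse r) (inverse c)"
  using assms unfolding has_value_def by (metis divide_eq_0_iff inverse_divide inverse_fract)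

lemma has_value_divide:
  assumes "has_value P r c" "has_value P s d" "d \<noteq> 0"
  shows "has_value P (r / s) (c / d)"
  using has_value_mult[OF assms(1) has_value_inverse[OF assms(2,3)]]
  by (simp add: divide_inverse)

lemma has_value_diff:
  assumes "has_value P r c" "has_value P s d"
  shows "has_value P (r - s) (c - d)"
proof -
  have "rf_const (-1) = -1"
    by (simp add: rf_const_def One_fract_def single_uminus)
  with has_value_add[OF assms(1) has_value_mult[OF has_value_const[of P "-1"] assms(2)]]
  show ?thesis by simp
qed

lemma has_value_sum:
  assumes "\<And>i. i \<in> A \<Longrightarrow> has_value P (f i) (g i)"
  shows "has_value P (sum f A) (sum g A)"
  using assms
  by (induction A rule: infinite_finite_induct) (auto intro: has_value_add has_value_0)

lemma has_value_affine_form: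
  assumes "\<And>j. 1 \<le> j \<Longrightarrow> j \<le> k \<Longrightarrow> has_value P (g j) (y j)"
  shows "has_value P (affine_form k (\<lambda>j. rf_const (c j)) g) (affine_form k c y)"
  unfolding affine_form_def using assms
  by (intro has_value_add has_value_sum has_value_mult has_value_const) auto

lemma rf_const_1: "rf_const 1 = 1"
  by (simp add: rf_const_def One_fract_def)

lemma rf_const_mult: "rf_const (c * d) = rf_const c * rf_const d"
  by (simp add: rf_const_def mult_single)

lemma rf_const_diff: "rf_const (c - d) = rf_const c - rf_const d"
  by (simp add: rf_const_def single_diff)


subsection \<open>Iterates of a linear fractional map\<close>

text \<open>A numerical orbit without zero denominators up to time \<open>N\<close> certifies that
  the symbolic iterate exists, because each symbolic denominator takes a nonzero value at the
  starting point \<open>P\<close>. Applied to a constant orbit it shows definedness; applied to a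
  perturbed one it refutes small periods.\<close>

lemma lfr_power_has_value:
  assumes "k \<ge> 1"
    and P: "\<And>i. 1 \<le> i \<Longrightarrow> i \<le> k \<Longrightarrow> P i = y i"
    and "\<And>n. n < N \<Longrightarrow> affine_form k \<beta> (\<lambda>j. y (n + j)) \<noteq> 0"
    and "\<And>n. n < N \<Longrightarrow> y (n + k + 1) =
          affine_form k \<alpha> (\<lambda>j. y (n + j)) / affine_form k \<beta> (\<lambda>j. y (n + j))"
  shows "\<exists>g. lfr_power k \<alpha> \<beta> N = Some g \<and> length g = k \<and>
            (\<forall>j<k. has_value P (g ! j) (y (N + j + 1)))"
  using assms(3,4)
proof (induction N)
  case 0
  show ?case
  proof -
    have "has_value P (rf_var (Suc j)) (y (Suc j))" if "j < k" for j
      using has_value_var[of P "Suc j"] P[of "Suc j"] that by simp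
    then show ?thesis by (simp add: rat_id_def del: upt_Suc)
  qed
next
  case (Suc N)
  then obtain g where g: "lfr_power k \<alpha> \<beta> N = Some g" "length g = k"
    "\<And>j. j < k \<Longrightarrow> has_value P (g ! j) (y (N + j + 1))"
    by (metis less_SucI)
  have val: "has_value P (affine_form k (\<lambda>j. rf_const (c j)) (\<lambda>j. g ! (j - 1)))
          (affine_form k c (\<lambda>j. y (N + j)))" for c
  proof (rule has_value_affine_form)
    fix j assume "1 \<le> j" "j \<le> k"
    then show "has_value P (g ! (j - 1)) (y (N + j))" using g(3)[of "j - 1"] by simp
  qed
  define n where "n = affine_form k (\<lambda>j. rf_const (\<alpha> j)) (\<lambda>j. g ! (j - 1))"
  define d where "d = affine_form k (\<lambda>j. rf_const (\<beta> j)) (\<lambda>j. g ! (j - 1))"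
  have nz: "affine_form k \<beta> (\<lambda>j. y (N + j)) \<noteq> 0" using Suc.prems(1) by simp
  have "d \<noteq> 0"
    using val[of \<beta>] nz has_value_unique[OF has_value_0] unfolding d_def by metis
  moreover have "has_value P (n / d) (y (N + k + 1))"
    unfolding n_def d_def using Suc.prems(2)[of N] has_value_divide[OF val val nz] by simp
  moreover have "has_value P ((tl g @ [n / d]) ! j) (y (Suc N + j + 1))" if "j < k" for j
  proof (cases "j = k - 1")
    case True
    then show ?thesis using \<open>has_value P (n / d) _\<close> assms(1) g(2) by (simp add: nth_append)
  next
    case False
    then have "Suc j < k" using that by simp
    then show ?thesis using g(2) g(3)[of "Suc j"] by (simp add: nth_append nth_tl less_diff_conv)
  qed
  moreover have "lfr_power k \<alpha> \<beta> (Suc N) = Some (tl g @ [n / d])"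
    using \<open>d \<noteq> 0\<close>
    by (simp only: lfr_power.simps g(1) Option.bind.bind_lunit lfr_compose_def Let_def
        flip: n_def d_def) simp
  ultimately show ?case
    using g(2) assms(1) by (simp del: lfr_power.simps)
qed

text \<open>Each iterate only shifts the component list and appends one entry, so all iterates are
  windows of a single sequence. That sequence solves the recurrence over the field of rational
  functions, where the field-level periodicity result applies.\<close>

lemma universal_sequence:
  assumes "k \<ge> 1" and "\<And>n. lfr_power k \<alpha> \<beta> n \<noteq> None"
  obtains X where
    "\<And>i. 1 \<le> i \<Longrightarrow> i \<le> k \<Longrightarrow> X i = rf_var i"
    "\<And>n. lfr_power k \<alpha> \<beta> n = Some (map X [n+1..<n+k+1])"
    "\<And>n. affine_form k (\<lambda>j. rf_const (\<beta> j)) (\<lambda>j. X (n + j)) \<noteq> 0"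
    "\<And>n. X (n + k + 1) = affine_form k (\<lambda>j. rf_const (\<alpha> j)) (\<lambda>j. X (n + j)) /
            affine_form k (\<lambda>j. rf_const (\<beta> j)) (\<lambda>j. X (n + j))"
proof -
  \<comment> \<open>Beyond \<open>k\<close>, the entry \<open>X n\<close> is the component newly
    appended by the iterate of order \<open>n - k\<close>.\<close>
  define X where "X n = (if n \<le> k then rf_var n else last (the (lfr_power k \<alpha> \<beta> (n - k))))" for n
  let ?A = "\<lambda>c n. affine_form k (\<lambda>j. rf_const (c j)) (\<lambda>j. X (n + j))"
  have step: "?A \<beta> n \<noteq> 0 \<and> X (n + k + 1) = ?A \<alpha> n / ?A \<beta> n \<and>
      lfr_power k \<alpha> \<beta> (Suc n) = Some (map X [Suc n+1..<Suc n+k+1])"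
    if "lfr_power k \<alpha> \<beta> n = Some (map X [n+1..<n+k+1])" for n
  proof -
    have A: "affine_form k (\<lambda>j. rf_const (c j)) (\<lambda>j. map X [n+1..<n+k+1] ! (j - 1)) = ?A c n" for c
      unfolding affine_form_def
      by (intro arg_cong2[where f = "(+)"] refl sum.cong) (auto simp del: upt_Suc)
    have P: "lfr_power k \<alpha> \<beta> (Suc n) =
      (if ?A \<beta> n = 0 then None else Some (tl (map X [n+1..<n+k+1]) @ [?A \<alpha> n / ?A \<beta> n]))"
      using that unfolding lfr_power.simps
      by (simp only: Option.bind.bind_lunit lfr_compose_def Let_def A)
    with assms(2)[of "Suc n"] have nz: "?A \<beta> n \<noteq> 0" by (auto split: if_splits)
    with P have P': "lfr_power k \<alpha> \<beta> (Suc n) =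
      Some (tl (map X [n+1..<n+k+1]) @ [?A \<alpha> n / ?A \<beta> n])" by simp
    moreover have "X (n + k + 1) = last (the (lfr_power k \<alpha> \<beta> (Suc n)))"
      by (simp add: X_def del: lfr_power.simps)
    ultimately have X: "X (n + k + 1) = ?A \<alpha> n / ?A \<beta> n"
      by (simp only: option.sel last_snoc)
    have "tl (map X [n+1..<n+k+1]) @ [X (n + k + 1)] = map X [Suc n+1..<Suc n+k+1]"
      using assms(1) by (simp add: map_tl[symmetric])
    then show ?thesis using nz X P' by metis
  qed
  have pow: "lfr_power k \<alpha> \<beta> n = Some (map X [n+1..<n+k+1])" for n
  proof (induction n)
    case 0
    show ?case by (auto simp: rat_id_def X_def simp del: upt_Suc)
  qed (use step in blast)
  show ?thesis
  proof (rule that[of X])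
    show "X i = rf_var i" if "1 \<le> i" "i \<le> k" for i
      using that by (simp add: X_def)
  qed (use pow step in blast)+
qed

lemma affine_form_cong:
  assumes "\<And>j. 1 \<le> j \<Longrightarrow> j \<le> k \<Longrightarrow> x j = y j"
  shows "affine_form k c x = affine_form k c y"
  unfolding affine_form_def using assms by (intro arg_cong2[where f = "(+)"] refl sum.cong) auto

text \<open>Division is total, with value 0 at denominator 0, so every start generates a sequence;
  that the denominators do not vanish is checked separately where it matters.\<close>

lemma lfr_orbit_exists:
  obtains y where "\<And>i. i \<le> k \<Longrightarrow> y i = p i"
    and "\<And>n. y (n + k + 1) =
      affine_form k \<alpha> (\<lambda>j. y (n + j)) / affine_form k \<beta> (\<lambda>j. y (n + j))"
proof -
  \<comment> \<open>A state is a window of \<open>k + 1\<close> consecutive entries at positions 0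
    to \<open>k\<close>; the new entry arrives at position \<open>k\<close>.\<close>
  define step where "step w j =
    (if j < k then w (Suc j) else affine_form k \<alpha> w / affine_form k \<beta> w)" for w j
  define st where "st n = (step ^^ n) p" for n
  have shift: "st n j = st (n + j) 0" if "j \<le> k" for n j
    using that
  proof (induction j arbitrary: n)
    case (Suc j)
    have "st n (Suc j) = st (Suc n) j" using Suc.prems by (simp add: st_def step_def)
    with Suc show ?case by simp
  qed simp
  show ?thesis
  proof (rule that[of "\<lambda>n. st n 0"])
    show "st i 0 = p i" if "i \<le> k" for i
      using shift[OF that, of 0] by (simp add: st_def)
    show "st (n + k + 1) 0 = affine_form k \<alpha> (\<lambda>j. st (n + j) 0) / affine_form k \<beta> (\<lambda>j. st (n + j) 0)"
      for n
    proof -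
      have "st (n + k + 1) 0 = st (Suc n) k" using shift[of k "Suc n"] by simp
      also have "\<dots> = affine_form k \<alpha> (st n) / affine_form k \<beta> (st n)"
        by (simp add: st_def step_def)
      finally show ?thesis
        using affine_form_cong[of k "st n" "\<lambda>j. st (n + j) 0"] shift by metis
    qed
  qed
qed


subsection \<open>Periodicity over a field\<close>

text \<open>The weighted sums at \<open>n\<close> and \<open>n + 1\<close> differ, up to the factor
  \<open>a\<close>, only in their end terms, and \<open>a ^ k = -1\<close> fixes the lower one.
  Substituting the two instances of the recurrence removes the sums; the remaining constant is -1,
  which completes the product on the left.\<close>

lemma product_relation:
  fixes u :: "nat \<Rightarrow> 'a::field"
  assumes k: "k \<ge> 1" and ak: "a ^ k = -1" and a1: "a \<noteq> 1"
    and rec: "\<And>i. i \<in> {n, n + 1} \<Longrightarrow>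
        u (i + k + 1) * (u (i + 1) - 1) = (\<Sum>j=2..k. a ^ (k + 1 - j) * u (i + j)) - 1 / (1 - a)"
  shows "(u (n + k + 2) - 1) * (u (n + 2) - 1) = a * u (n + k + 1) * u (n + 1)"
proof -
  define S where "S i = (\<Sum>j=2..k. a ^ (k + 1 - j) * u (i + j))" for i
  \<comment> \<open>These weights make the sum of \<open>g (Suc j) - g j\<close> both telescope and
    equal \<open>S (n + 1) - a * S n\<close>.\<close>
  define g where "g j = a ^ (k + 2 - j) * u (n + j)" for j
  have "(\<Sum>j=2..k. g (Suc j) - g j) = g (Suc k) - g 2"
    using k by (intro sum_Suc_diff) simp
  moreover have "(\<Sum>j=2..k. g (Suc j)) = S (n + 1)"
    by (simp add: g_def S_def)
  moreover have "(\<Sum>j=2..k. g j) = a * S n"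
    unfolding sum_distrib_left S_def
    by (intro sum.cong) (auto simp: g_def Suc_diff_le)
  ultimately have S: "S (n + 1) = a * S n + a * u (n + k + 1) + u (n + 2)"
    by (simp add: sum_subtractf g_def ak algebra_simps)
  define c where "c = 1 / (1 - a)"
  \<comment> \<open>This is what the constant \<open>1 / (1 - a)\<close> is chosen for:
    \<open>a * c - c\<close> collapses to -1.\<close>
  have c: "a * c = c - 1"
    using a1 by (simp add: c_def divide_simps)
  have r0: "S n = u (n + k + 1) * (u (n + 1) - 1) + c"
    using rec[of n] by (simp add: c_def S_def)
  have r1: "u (n + k + 2) * (u (n + 2) - 1) = S (n + 1) - c"
    using rec[of "n + 1"] by (simp add: c_def S_def)
  have "u (n + k + 2) * (u (n + 2) - 1) =
      a * u (n + k + 1) * u (n + 1) + a * c - c + u (n + 2)"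
    unfolding r1 S r0 by (simp add: algebra_simps)
  then show ?thesis unfolding c by (simp add: algebra_simps)
qed

text \<open>If \<open>u m\<close> were 0, the product relation would force one of its two left
  factors to vanish, against \<open>ne1\<close>. Hence division is allowed, and comparing the
  relation at \<open>m\<close> and at \<open>m + k\<close> cancels the common ratio.\<close>

lemma ratio_relation:
  fixes u :: "nat \<Rightarrow> 'a::field"
  assumes a: "a \<noteq> 0"
    and rel: "\<forall>m\<ge>1. (u (m + k + 1) - 1) * (u (m + 1) - 1) = a * u (m + k) * u m"
    and ne1: "\<forall>m\<ge>1. u m \<noteq> 1"
    and m: "m \<ge> 1"
  shows "u m \<noteq> 0"
    and "(u (m + 1) - 1) / u m * ((u (m + k + 1) - 1) / u (m + k)) = a"
    and "(u (m + 2 * k + 1) - 1) / u (m + 2 * k) = (u (m + 1) - 1) / u m"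
proof -
  have nz: "u m \<noteq> 0" if "m \<ge> 1" for m
    using rel ne1 that by (metis le_add2 mult_eq_0_iff right_minus_eq)
  have prod: "(u (m + 1) - 1) / u m * ((u (m + k + 1) - 1) / u (m + k)) = a" if "m \<ge> 1" for m
    using rel[rule_format, OF that] nz[OF that] nz[of "m + k"] that by (simp add: field_simps)
  show "u m \<noteq> 0" "(u (m + 1) - 1) / u m * ((u (m + k + 1) - 1) / u (m + k)) = a"
    using nz prod m by blast+
  have "(u (m + k + 1) - 1) / u (m + k) * ((u (m + k + k + 1) - 1) / u (m + k + k)) = a"
    using prod[of "m + k"] m by simp
  with prod[OF m] a have "(u (m + 1) - 1) / u m = (u (m + k + k + 1) - 1) / u (m + k + k)"
    by (metis mult.commute mult_cancel_left mult_zero_left)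
  then show "(u (m + 2 * k + 1) - 1) / u (m + 2 * k) = (u (m + 1) - 1) / u m"
    by (simp add: mult_2 add.assoc)
qed

text \<open>Since \<open>u\<close> obeys an affine recursion with \<open>2 * k\<close>-periodic
  slopes, the difference between \<open>u\<close> and its shift by \<open>2 * k\<close> obeys the
  homogeneous one. Over \<open>2 * k\<close> steps it is multiplied by the product of the slopes,
  which pair up into \<open>k\<close> factors \<open>a\<close>, giving -1; so consecutive
  differences cancel.\<close>

lemma four_k_periodic:
  fixes u :: "nat \<Rightarrow> 'a::field"
  assumes ak: "a ^ k = -1"
    and rel: "\<forall>m\<ge>1. (u (m + k + 1) - 1) * (u (m + 1) - 1) = a * u (m + k) * u m"
    and ne1: "\<forall>m\<ge>1. u m \<noteq> 1"
    and m: "m \<ge> 1"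
  shows "u (m + 4 * k) = u m"
proof (cases "k = 0")
  case False
  then have a: "a \<noteq> 0" using ak by (auto simp: power_0_left)
  note R = ratio_relation[OF a rel ne1]
  define r where "r i = (u (i + 1) - 1) / u i" for i
  have affine: "u (i + 1) = r i * u i + 1" if "i \<ge> 1" for i
    using R(1)[OF that] by (simp add: r_def)
  have split: "(\<Prod>i<n + l. f i) = (\<Prod>i<n. f i) * (\<Prod>i<l. f (n + i))" for n l and f :: "nat \<Rightarrow> 'a"
    by (induction l) (simp_all add: mult.assoc)
  have "u (m + 2 * k + j) - u (m + j) = (\<Prod>i<j. r (m + i)) * (u (m + 2 * k) - u m)" for j
  proof (induction j)
    case (Suc j)
    have "u (m + 2 * k + Suc j) - u (m + Suc j) = r (m + j) * (u (m + 2 * k + j) - u (m + j))"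
    proof -
      have "r (m + 2 * k + j) = r (m + j)"
        using R(3)[of "m + j"] m by (simp add: r_def ac_simps)
      then show ?thesis
        using affine[of "m + j"] affine[of "m + 2 * k + j"] m by (simp add: algebra_simps)
    qed
    also have "\<dots> = r (m + j) * ((\<Prod>i<j. r (m + i)) * (u (m + 2 * k) - u m))"
      unfolding Suc.IH ..
    finally show ?case by (simp add: ac_simps)
  qed simp
  from this[of "2 * k"]
  have "u (m + 2 * k + 2 * k) - u (m + 2 * k) = (\<Prod>i<2 * k. r (m + i)) * (u (m + 2 * k) - u m)" .
  moreover have "(\<Prod>i<2 * k. r (m + i)) = (\<Prod>i<k. r (m + i) * r (m + i + k))"
    unfolding mult_2 split prod.distrib by (simp add: ac_simps)
  moreover have "\<dots> = -1"
    using R(2)[of "m + i" for i] m ak by (simp add: r_def)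
  ultimately show ?thesis by (simp add: algebra_simps)
qed simp

text \<open>
  The homomorphism \<open>h\<close> is the identity on the complex numbers or the embedding \<^const>\<open>rf_const\<close> of the
  constants into the rational functions.
\<close>

lemma scaled_affine_forms:
  fixes h :: "complex \<Rightarrow> 'b::field"
  assumes h1: "h 1 = 1" and hm: "\<And>x y. h (x * y) = h x * h y"
    and hd: "\<And>x y. h (x - y) = h x - h y"
    and k: "k \<ge> 2" and ak: "a ^ k = -1"
  shows "h a * affine_form k (\<lambda>j. h (beta_coeff k a j)) x = h a * x 1 - 1"
    and "h a ^ 2 * affine_form k (\<lambda>j. h (alpha_coeff k a j)) x =
      (\<Sum>j=2..k. h a ^ (k + 1 - j) * (h a * x j)) - 1 / (1 - h a)"
    and "h a ^ k = -1" and "h a \<noteq> 1"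
proof -
  have a1: "a \<noteq> 1" using ak by auto
  have h0: "h 0 = 0" using hd[of 0 0] by simp
  have hneg: "h (-1) = -1" using hd[of 0 1] h0 h1 by simp
  have hp: "h (x ^ n) = h x ^ n" for x n by (induction n) (simp_all add: h1 hm)
  show "h a ^ k = -1" using hp[of a k] ak hneg by simp
  \<comment> \<open>An invertible element has an invertible image, so \<open>h a\<close> differs
    from 1 without injectivity being assumed.\<close>
  have hinv: "h (1 - a) * h (1 / (1 - a)) = 1"
    using hm[of "1 - a" "1 / (1 - a)"] a1 h1 by simp
  then show "h a \<noteq> 1" using hd h1 by auto
  have hdiv: "h (1 / (1 - a)) = 1 / (1 - h a)"
    using hinv \<open>h a \<noteq> 1\<close> by (simp add: hd h1 field_simps)
  have C: "h a ^ 2 * h (a ^ (k - 2) / (1 - a)) = - (1 / (1 - h a))"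
  proof -
    have "a ^ 2 * a ^ (k - 2) = -1"
      using k ak by (metis le_add_diff_inverse power_add)
    then have "a ^ 2 * (a ^ (k - 2) / (1 - a)) = -1 * (1 / (1 - a))"
      by simp
    then show ?thesis using hm hp hneg hdiv by (metis mult_minus1)
  qed
  have A: "h a * h (a ^ (k - 1)) = -1"
    using k ak hneg by (simp flip: hm power_Suc)
  have "(\<Sum>j=1..k. h (beta_coeff k a j) * x j) = (\<Sum>j=1..k. if j = 1 then x j else 0)"
    by (intro sum.cong) (auto simp: beta_coeff_def h0 h1)
  then have "affine_form k (\<lambda>j. h (beta_coeff k a j)) x = h (a ^ (k - 1)) + x 1"
    using k by (simp add: affine_form_def beta_coeff_def)
  then show "h a * affine_form k (\<lambda>j. h (beta_coeff k a j)) x = h a * x 1 - 1"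
    using A by (simp add: distrib_left)
  have "(\<Sum>j=1..k. h (alpha_coeff k a j) * x j) = (\<Sum>j=2..k. h a ^ (k - j) * x j)"
  proof -
    have "{1..k} = insert 1 {2..k}" using k by auto
    then have "(\<Sum>j=1..k. h (alpha_coeff k a j) * x j) = (\<Sum>j=2..k. h (alpha_coeff k a j) * x j)"
      by (simp add: alpha_coeff_def h0)
    also have "\<dots> = (\<Sum>j=2..k. h a ^ (k - j) * x j)"
      by (intro sum.cong) (auto simp: alpha_coeff_def hp)
    finally show ?thesis .
  qed
  then have "h a ^ 2 * affine_form k (\<lambda>j. h (alpha_coeff k a j)) x =
      h a ^ 2 * h (a ^ (k - 2) / (1 - a)) + (\<Sum>j=2..k. h a ^ 2 * (h a ^ (k - j) * x j))"
    by (simp add: affine_form_def alpha_coeff_def distrib_left sum_distrib_left)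
  also have "(\<Sum>j=2..k. h a ^ 2 * (h a ^ (k - j) * x j)) =
      (\<Sum>j=2..k. h a ^ (k + 1 - j) * (h a * x j))"
    by (intro sum.cong) (auto simp: Suc_diff_le power2_eq_square)
  finally show "h a ^ 2 * affine_form k (\<lambda>j. h (alpha_coeff k a j)) x =
      (\<Sum>j=2..k. h a ^ (k + 1 - j) * (h a * x j)) - 1 / (1 - h a)"
    using C by simp
qed

text \<open>Of the factor \<open>h a ^ 2\<close>, one \<open>h a\<close> scales the new term and the
  other scales the denominator into \<open>h a * x 1 - 1\<close>. A nonzero denominator thus means
  that the scaled term differs from 1.\<close>

lemma scaled_recurrence:
  fixes h :: "complex \<Rightarrow> 'b::field"
  assumes hom: "h 1 = 1" "\<And>x y. h (x * y) = h x * h y" "\<And>x y. h (x - y) = h x - h y"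
    and k: "k \<ge> 2" and ak: "a ^ k = -1"
    and nz: "affine_form k (\<lambda>j. h (beta_coeff k a j)) x \<noteq> 0"
    and z: "z = affine_form k (\<lambda>j. h (alpha_coeff k a j)) x /
      affine_form k (\<lambda>j. h (beta_coeff k a j)) x"
  shows "h a * x 1 \<noteq> 1"
    and "(h a * z) * (h a * x 1 - 1) =
      (\<Sum>j=2..k. h a ^ (k + 1 - j) * (h a * x j)) - 1 / (1 - h a)"
proof -
  note S = scaled_affine_forms(1,2)[of h, OF hom k ak, of x] scaled_affine_forms(3)[of h, OF hom k ak]
  have "h a \<noteq> 0" using S(3) k by (auto simp: power_0_left)
  then show "h a * x 1 \<noteq> 1" using S(1) nz by auto
  have "(h a * z) * (h a * affine_form k (\<lambda>j. h (beta_coeff k a j)) x) =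
      h a ^ 2 * affine_form k (\<lambda>j. h (alpha_coeff k a j)) x"
    using nz z by (simp add: power2_eq_square)
  then show "(h a * z) * (h a * x 1 - 1) =
      (\<Sum>j=2..k. h a ^ (k + 1 - j) * (h a * x j)) - 1 / (1 - h a)"
    unfolding S(1,2) .
qed

text \<open>Stated for a general \<open>h\<close> in order to serve twice: for complex sequences,
  and for the sequence of rational functions generated by the indeterminates.\<close>

lemma scaled_sequence:
  fixes h :: "complex \<Rightarrow> 'b::field" and x :: "nat \<Rightarrow> 'b"
  assumes hom: "h 1 = 1" "\<And>x y. h (x * y) = h x * h y" "\<And>x y. h (x - y) = h x - h y"
    and k: "k \<ge> 2" and ak: "a ^ k = -1"
    and nz: "\<And>n. affine_form k (\<lambda>j. h (beta_coeff k a j)) (\<lambda>j. x (n + j)) \<noteq> 0"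
    and rec: "\<And>n. x (n + k + 1) = affine_form k (\<lambda>j. h (alpha_coeff k a j)) (\<lambda>j. x (n + j)) /
      affine_form k (\<lambda>j. h (beta_coeff k a j)) (\<lambda>j. x (n + j))"
  defines "u \<equiv> \<lambda>n. h a * x n"
  shows "\<forall>m\<ge>1. (u (m + k + 1) - 1) * (u (m + 1) - 1) = h a * u (m + k) * u m"
    and "\<forall>m\<ge>1. u m \<noteq> 1"
    and "\<forall>m\<ge>1. x (m + 4 * k) = x m"
proof -
  note S = scaled_affine_forms(3,4)[of h, OF hom k ak]
  note rec' = scaled_recurrence[of h, OF hom k ak nz rec]
  show rel: "\<forall>m\<ge>1. (u (m + k + 1) - 1) * (u (m + 1) - 1) = h a * u (m + k) * u m"
  proof (intro allI impI)
    fix m :: nat assume "m \<ge> 1"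
    then obtain n where m: "m = n + 1" by (metis le_add_diff_inverse2)
    show "(u (m + k + 1) - 1) * (u (m + 1) - 1) = h a * u (m + k) * u m"
      using product_relation[OF _ S, where n = n and u = u] rec'(2) k by (simp add: m u_def)
  qed
  show ne: "\<forall>m\<ge>1. u m \<noteq> 1"
  proof (intro allI impI)
    fix m :: nat assume "m \<ge> 1"
    then obtain n where m: "m = n + 1" by (metis le_add_diff_inverse2)
    show "u m \<noteq> 1" using rec'(1)[of n] by (simp add: m u_def)
  qed
  have "h a \<noteq> 0" using S(1) k by (auto simp: power_0_left)
  then show "\<forall>m\<ge>1. x (m + 4 * k) = x m"
    using four_k_periodic[OF S(1) rel ne] by (simp add: u_def)
qed


subsection \<open>The least period\<close>

lemma periodic_mult:
  fixes f :: "nat \<Rightarrow> 'a"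
  assumes "\<And>m. m \<ge> 1 \<Longrightarrow> f (m + p) = f m" "m \<ge> 1"
  shows "f (m + p * c) = f m"
proof (induction c)
  case (Suc c)
  then show ?case using assms(1)[of "m + p * c"] assms(2) by (simp add: ac_simps)
qed simp

text \<open>Bezout over the naturals, \<open>p * x = q * y + gcd p q\<close>, keeps all indices
  moving upwards.\<close>

lemma periodic_gcd:
  fixes f :: "nat \<Rightarrow> 'a"
  assumes p: "\<And>m. m \<ge> 1 \<Longrightarrow> f (m + p) = f m" and q: "\<And>m. m \<ge> 1 \<Longrightarrow> f (m + q) = f m"
    and "p \<noteq> 0" "m \<ge> 1"
  shows "f (m + gcd p q) = f m"
proof -
  obtain x y where xy: "p * x = q * y + gcd p q" using bezout_nat[OF \<open>p \<noteq> 0\<close>, of q] by blast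
  have "f (m + gcd p q) = f (m + gcd p q + q * y)"
    using periodic_mult[of f q "m + gcd p q" y] q assms(4) by simp
  also have "\<dots> = f (m + p * x)" by (simp add: xy ac_simps)
  also have "\<dots> = f m" using periodic_mult[of f p] p assms(4) by blast
  finally show ?thesis .
qed

section \<open>An explicit orbit near a fixed point\<close>

text \<open>For a constant sequence the product relation reads \<open>(v - 1)^2 = a * v^2\<close>,
  which is why a square root \<open>s\<close> of \<open>a\<close> enters, with
  \<open>v - 1 = s * v\<close>. The geometric sum, evaluated with \<open>a ^ k = -1\<close>,
  confirms that such a \<open>v\<close> solves the recurrence itself.\<close>

lemma fixed_point_sum:
  fixes s v :: complex
  assumes k: "k \<ge> 1" and ak: "(s\<^sup>2) ^ k = -1" and v: "v - s * v = 1"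
  shows "(\<Sum>j=2..k. (s\<^sup>2) ^ (k + 1 - j) * v) - 1 / (1 - s\<^sup>2) = v * (v - 1)"
proof -
  define a where "a = s\<^sup>2"
  have a1: "1 - a \<noteq> 0" using ak by (auto simp: a_def)
  have "(\<Sum>j=2..k. a ^ (k + 1 - j)) = (\<Sum>i<k - 1. a ^ Suc i)"
    by (rule sum.reindex_bij_witness[of _ "\<lambda>i. k - i" "\<lambda>j. k - j"]) (auto simp: Suc_diff_le)
  also have "\<dots> = a * (\<Sum>i<k - 1. a ^ i)" by (simp add: sum_distrib_left)
  also have "\<dots> = (a - a * a ^ (k - 1)) / (1 - a)"
    using a1 by (simp add: sum_gp_strict right_diff_distrib)
  also have "a * a ^ (k - 1) = -1"
    using k ak by (simp add: a_def flip: power_Suc)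
  finally have S: "(\<Sum>j=2..k. a ^ (k + 1 - j)) = (a + 1) / (1 - a)" by simp
  have sv: "s * v = v - 1" using v by (metis add_diff_cancel_left' diff_eq_eq)
  have av: "a * v = s * v - s"
    unfolding a_def power2_eq_square mult.assoc by (simp add: sv right_diff_distrib)
  have avv: "a * (v * (v - 1)) = (s * v) * (s * v) - (s * v) * s"
    unfolding a_def power2_eq_square by (simp add: algebra_simps)
  have "(\<Sum>j=2..k. a ^ (k + 1 - j) * v) - 1 / (1 - a) = ((a + 1) * v - 1) / (1 - a)"
    unfolding sum_distrib_right[symmetric] S by (simp add: diff_divide_distrib)
  also have "(a + 1) * v - 1 = (1 - a) * (v * (v - 1))"
  proof -
    have "(1 - a) * (v * (v - 1)) = v * (v - 1) - a * (v * (v - 1))"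
      by (rule left_diff_distrib[of 1 a "v * (v - 1)", simplified])
    also have "\<dots> = v + s * v - s - 1"
      unfolding avv sv by (simp add: algebra_simps) (simp add: sv)
    finally show ?thesis by (simp add: distrib_right av sv)
  qed
  finally show ?thesis using a1 unfolding a_def by simp
qed

text \<open>
  With \<open>s\<^sup>2 = a\<close>, \<open>v = 1 / (1 - s)\<close> is a fixed point of the recurrence for \<open>u\<^sub>n = a x\<^sub>n\<close>; the orbit below
  starts at a perturbation of it in the \<open>k\<close>-th coordinate only.
\<close>

lemma special_orbit:
  fixes s v W :: complex
  assumes k: "k \<ge> 3" and ak: "(s\<^sup>2) ^ k = -1" and v: "v - s * v = 1"
    and W: "s + W \<noteq> 0" "v + W \<noteq> 0"
  obtains y where
    "\<And>n. n < k + 1 \<Longrightarrow> affine_form k (beta_coeff k (s\<^sup>2)) (\<lambda>j. y (n + j)) \<noteq> 0"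
    "\<And>n. n < k + 1 \<Longrightarrow> y (n + k + 1) = affine_form k (alpha_coeff k (s\<^sup>2)) (\<lambda>j. y (n + j)) /
       affine_form k (beta_coeff k (s\<^sup>2)) (\<lambda>j. y (n + j))"
    "\<And>i. 1 \<le> i \<Longrightarrow> i < k \<Longrightarrow> s\<^sup>2 * y i = v"
    "s\<^sup>2 * y k = v * (1 + W)"
    "\<And>i. 1 \<le> i \<Longrightarrow> i < k \<Longrightarrow> s\<^sup>2 * y (k + i) = v + s ^ i * W"
    "(s\<^sup>2 * y (2 * k) - 1) * (s + W) = s * (s * v + s ^ k * W)"
    "(s\<^sup>2 * y (2 * k + 1) - 1) * (v + W) = s * v * (s\<^sup>2 * y (2 * k)) * (1 + W)"
proof -
  define a where "a = s\<^sup>2"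
  have ak: "a ^ k = -1" using ak by (simp add: a_def)
  have a1: "a \<noteq> 1" using ak by auto
  have a0: "a \<noteq> 0" using ak k by (auto simp: power_0_left)
  have s0: "s \<noteq> 0" using a0 by (auto simp: a_def)
  have v0: "v \<noteq> 0" using v by auto
  have sv: "v = s * v + 1" using v by (simp add: algebra_simps)
  have sv': "v - 1 = s * v" using sv by (metis add_diff_cancel_right')
  have k2: "k \<ge> 2" using k by simp
  obtain y where y: "\<And>i. i \<le> k \<Longrightarrow> y i = (if i = k then v * (1 + W) else v) / a"
    and yrec: "\<And>n. y (n + k + 1) = affine_form k (alpha_coeff k a) (\<lambda>j. y (n + j)) /
       affine_form k (beta_coeff k a) (\<lambda>j. y (n + j))"
    using lfr_orbit_exists[of k "\<lambda>i. (if i = k then v * (1 + W) else v) / a"] by blast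
  define u where "u n = a * y n" for n
  have u_lt: "u i = v" if "i < k" for i using y[of i] that a0 by (simp add: u_def)
  have u_k: "u k = v * (1 + W)" using y[of k] a0 by (simp add: u_def)
  note forms = scaled_affine_forms[where h = "\<lambda>x. x" and k = k and a = a, OF refl refl refl k2 ak]
  have nz: "affine_form k (beta_coeff k a) (\<lambda>j. y (n + j)) \<noteq> 0" if "u (n + 1) \<noteq> 1" for n
    using forms(1)[of "\<lambda>j. y (n + j)"] that by (auto simp: u_def)
  have step: "u (n + k + 1) * (u (n + 1) - 1) =
      (\<Sum>j=2..k. a ^ (k + 1 - j) * u (n + j)) - 1 / (1 - a)" if "u (n + 1) \<noteq> 1" for n
    using scaled_recurrence(2)[where h = "\<lambda>x. x" and k = k and a = a, OF refl refl refl k2 ak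
        nz[OF that] yrec[of n]] by (simp add: u_def)
  have rel: "(u (m + k + 1) - 1) * (u (m + 1) - 1) = a * u (m + k) * u m"
    if "m \<ge> 1" "u m \<noteq> 1" "u (m + 1) \<noteq> 1" for m
  proof -
    from that(1) obtain n where m: "m = n + 1" by (metis le_add_diff_inverse2)
    have "u (i + k + 1) * (u (i + 1) - 1) =
        (\<Sum>j=2..k. a ^ (k + 1 - j) * u (i + j)) - 1 / (1 - a)" if "i \<in> {n, n + 1}" for i
      using that \<open>u m \<noteq> 1\<close> \<open>u (m + 1) \<noteq> 1\<close> by (intro step) (auto simp: m)
    from product_relation[OF _ ak a1 this] show ?thesis using k by (simp add: m)
  qed
  have v1: "v \<noteq> 1" using sv s0 v0 by auto
  have uk1: "u k - 1 = v * (s + W)" using sv by (simp add: u_k algebra_simps)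
  have ukne: "u k \<noteq> 1" using uk1 v0 W by auto
  \<comment> \<open>Only the summand \<open>j = k\<close>, with weight \<open>a\<close>, sees the
    perturbation; the rest is the fixed-point identity.\<close>
  have u_Suc_k: "u (k + 1) = v + s * W"
  proof -
    have "(\<Sum>j=2..k. a ^ (k + 1 - j) * u j) =
        (\<Sum>j=2..k. a ^ (k + 1 - j) * v + (if j = k then a * (v * W) else 0))"
      by (intro sum.cong) (auto simp: u_lt u_k algebra_simps)
    also have "\<dots> = (\<Sum>j=2..k. a ^ (k + 1 - j) * v) + a * (v * W)"
      using k by (simp add: sum.distrib sum.delta)
    finally have "u (k + 1) * (u 1 - 1) = v * (v - 1) + a * (v * W)"
      using step[of 0] fixed_point_sum[of k s v] ak v k v1 u_lt[of 1] by (simp add: a_def)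
    moreover have "u 1 = v" using u_lt[of 1] k by simp
    ultimately have "u (k + 1) * (s * v) = v * (s * v) + s * s * (v * W)"
      using sv' by (simp only: a_def power2_eq_square)
    then have "(s * v) * u (k + 1) = (s * v) * (v + s * W)"
      by (simp add: algebra_simps)
    then show ?thesis using s0 v0 by simp
  qed
  \<comment> \<open>While \<open>u i\<close> and \<open>u (i + 1)\<close> both equal
    \<open>v\<close>, the product relation reduces to
    \<open>u (i + k + 1) - 1 = s * u (i + k)\<close>, so the deviation from \<open>v\<close> is
    multiplied by \<open>s\<close> at each step.\<close>
  have u_mid: "u (k + i) = v + s ^ i * W" if "1 \<le> i" "i < k" for i
    using that
  proof (induction i rule: nat_induct_at_least)
    case base
    show ?case using u_Suc_k by simp
  next
    case (Suc i)
    have "(u (i + k + 1) - 1) * (s * v) = a * (v + s ^ i * W) * v"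
    proof -
      have "u i = v" "u (i + 1) = v" "u (i + k) = v + s ^ i * W"
        using Suc u_lt[of i] u_lt[of "i + 1"] by (auto simp: add.commute)
      then show ?thesis using rel[of i] Suc.hyps v1 by (simp add: sv')
    qed
    then have "(s * v) * (u (i + k + 1) - 1) = (s * v) * (s * v + s ^ Suc i * W)"
      by (simp add: a_def power2_eq_square algebra_simps)
    then have "u (i + k + 1) - 1 = s * v + s ^ Suc i * W" using s0 v0 by simp
    then have "u (i + k + 1) = (s * v + 1) + s ^ Suc i * W" by (simp add: algebra_simps)
    then show ?case using sv by (simp add: ac_simps)
  qed
  have u_2k: "(u (2 * k) - 1) * (s + W) = s * (s * v + s ^ k * W)"
  proof -
    have "(u (2 * k) - 1) * (u k - 1) = a * u (k + (k - 1)) * u (k - 1)"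
      using rel[of "k - 1"] k u_lt[of "k - 1"] v1 ukne by (simp add: mult_2)
    also have "\<dots> = a * (v + s ^ (k - 1) * W) * v"
      using u_mid[of "k - 1"] u_lt[of "k - 1"] k by simp
    also have "\<dots> = v * (s * (s * v + s * s ^ (k - 1) * W))"
      by (simp add: a_def power2_eq_square algebra_simps)
    also have "s * s ^ (k - 1) = s ^ k" using k by (simp flip: power_Suc)
    finally show ?thesis using v0 unfolding uk1 by simp
  qed
  have uk1': "u (k + 1) - 1 = s * (v + W)" using u_Suc_k sv by (simp add: algebra_simps)
  have u_2k1: "(u (2 * k + 1) - 1) * (v + W) = s * v * u (2 * k) * (1 + W)"
  proof -
    have "u (k + 1) \<noteq> 1" using uk1' s0 W by auto
    then have "(u (2 * k + 1) - 1) * (u (k + 1) - 1) = a * u (2 * k) * u k"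
      using rel[of k] k ukne by (simp add: mult_2)
    then have "s * ((u (2 * k + 1) - 1) * (v + W)) = s * (s * v * u (2 * k) * (1 + W))"
      unfolding uk1' u_k a_def power2_eq_square by (simp add: algebra_simps)
    then show ?thesis using s0 by simp
  qed
  \<comment> \<open>The factors \<open>s + W\<close> and \<open>v + W\<close> keep
    \<open>u k\<close> and \<open>u (k + 1)\<close> away from 1; all earlier terms are
    \<open>v\<close>.\<close>
  have ne: "u (n + 1) \<noteq> 1" if "n < k + 1" for n
    using that u_lt[of "n + 1"] v1 ukne uk1' s0 W
    by (cases "n + 1 < k"; cases "n + 1 = k"; cases "n = k") auto
  show ?thesis
  proof (rule that[of y, folded a_def, folded u_def])
    show "affine_form k (beta_coeff k a) (\<lambda>j. y (n + j)) \<noteq> 0" if "n < k + 1" for n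
      by (rule nz[OF ne[OF that]])
  qed (rule yrec u_lt u_k u_mid u_2k u_2k1 | assumption)+
qed

text \<open>Every condition is affine in \<open>W\<close> with nonzero slope, so each excludes one
  value and finitely many are excluded in all.\<close>

lemma generic_parameter:
  fixes s v :: complex
  assumes "s \<noteq> 0" "v \<noteq> 0"
  obtains W where "W \<noteq> 0" "s + W \<noteq> 0" "2 * s + W \<noteq> 0" "v * (1 + s) - s + v * W \<noteq> 0"
    "s * (s ^ k - 1) + s ^ (k + 1) * W \<noteq> 0" "\<And>i. i < k \<Longrightarrow> v + s ^ i * W \<noteq> 0"
proof -
  let ?B = "{0, -s, -2 * s, (s - v * (1 + s)) / v, - (s * (s ^ k - 1)) / s ^ (k + 1)} \<union>
    (\<lambda>i. - v / s ^ i) ` {..<k}"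
  have "finite ?B" by simp
  then obtain W where W: "W \<notin> ?B"
    using ex_new_if_finite[OF infinite_UNIV_char_0] by blast
  have lin: "p + q * W \<noteq> 0" if "W \<noteq> - p / q" "q \<noteq> 0" for p q :: complex
  proof
    assume "p + q * W = 0"
    then have "q * W = - p" by (simp add: add_eq_0_iff)
    then show False using that by (metis nonzero_eq_divide_eq mult.commute)
  qed
  show ?thesis
  proof (rule that[of W])
    show "W \<noteq> 0" using W by blast
    have "W \<noteq> - s" "W \<noteq> - 2 * s" using W by blast+
    then show "s + W \<noteq> 0" "2 * s + W \<noteq> 0" using lin[of s 1] lin[of "2 * s" 1] by simp_all
    have "W \<noteq> (s - v * (1 + s)) / v" using W by blast
    then show "v * (1 + s) - s + v * W \<noteq> 0"
      using assms by (intro lin) simp_all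
    have "W \<noteq> - (s * (s ^ k - 1)) / s ^ (k + 1)" using W by blast
    then show "s * (s ^ k - 1) + s ^ (k + 1) * W \<noteq> 0"
      by (rule lin) (use assms in simp)
    show "v + s ^ i * W \<noteq> 0" if "i < k" for i
    proof (rule lin)
      show "W \<noteq> - v / s ^ i" using W that by blast
    qed (use assms in simp)
  qed
qed

text \<open>The first claim rules out the period \<open>2 * k\<close> of \<open>u\<close>; the
  second, a cross-multiplied equation between ratios at \<open>k - 1 + d\<close> and
  \<open>k - 1\<close>, rules out a period \<open>d\<close> of the ratios. In each case the equation
  reduces to the vanishing of a product whose factors are nonzero by the choice of
  \<open>W\<close>.\<close>

lemma special_orbit_not_periodic:
  fixes s v W :: complex and u :: "nat \<Rightarrow> complex"
  assumes k: "k \<ge> 3" and v: "v - s * v = 1" and nz: "s \<noteq> 0" "v \<noteq> 0"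
    and W: "W \<noteq> 0" "s + W \<noteq> 0" "2 * s + W \<noteq> 0" "v * (1 + s) - s + v * W \<noteq> 0"
      "s * (s ^ k - 1) + s ^ (k + 1) * W \<noteq> 0" "\<And>i. i < k \<Longrightarrow> v + s ^ i * W \<noteq> 0"
    and u_lt: "\<And>i. 1 \<le> i \<Longrightarrow> i < k \<Longrightarrow> u i = v"
    and u_k: "u k = v * (1 + W)"
    and u_mid: "\<And>i. 1 \<le> i \<Longrightarrow> i < k \<Longrightarrow> u (k + i) = v + s ^ i * W"
    and u_2k: "(u (2 * k) - 1) * (s + W) = s * (s * v + s ^ k * W)"
    and u_2k1: "(u (2 * k + 1) - 1) * (v + W) = s * v * u (2 * k) * (1 + W)"
  shows "u (2 * k + 1) \<noteq> u 1"
    and "1 \<le> d \<Longrightarrow> d \<le> k \<Longrightarrow> (u k - 1) * u (k - 1 + d) \<noteq> (u (k + d) - 1) * u (k - 1)"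
proof -
  have v': "v = s * v + 1" using v unfolding diff_eq_eq by (simp only: add.commute)
  have sv: "s * v = v - 1" using v' by (metis add_diff_cancel_right')
  have uk1: "u k - 1 = v * (s + W)"
    using sv by (simp add: u_k algebra_simps)
  show "u (2 * k + 1) \<noteq> u 1"
  proof
    assume "u (2 * k + 1) = u 1"
    then have "u (2 * k + 1) - 1 = s * v" using u_lt[of 1] k sv by simp
    with u_2k1 have "(s * v) * (v + W) = (s * v) * (u (2 * k) * (1 + W))"
      by (simp only: mult.assoc)
    then have "v + W = u (2 * k) * (1 + W)" using nz by simp
    then have "(v + W) * (s + W) = ((u (2 * k) - 1) * (s + W) + (s + W)) * (1 + W)"
      by (simp add: algebra_simps)
    then have "(v + W) * (s + W) = (s * (s * v + s ^ k * W) + (s + W)) * (1 + W)"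
      unfolding u_2k .
    \<comment> \<open>With \<open>v = p + 1\<close> the equation becomes polynomial in
      \<open>p\<close>, \<open>K\<close>, \<open>s\<close> and \<open>W\<close>, and everything but
      a multiple of \<open>W\<close> cancels.\<close>
    moreover define p K where "p = s * v" and "K = s * s ^ k"
    moreover have "s * (s * v + s ^ k * W) = p - s + K * W"
      unfolding sv distrib_left right_diff_distrib p_def K_def by (simp add: sv)
    moreover have "(v + W) * (s + W) = p + v * W + s * W + W * W"
      by (simp add: p_def algebra_simps)
    moreover have "v * W = p * W + W"
      using arg_cong[OF v', of "\<lambda>z. z * W"] by (simp add: p_def distrib_right)
    ultimately have "p + (p * W + W) + s * W + W * W = (p - s + K * W + (s + W)) * (1 + W)"
      by simp
    then have "s * W = K * W + K * W * W"
      by (simp add: algebra_simps)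
    then have "W * (s * (s ^ k - 1) + s ^ (k + 1) * W) = 0"
      by (simp add: K_def algebra_simps)
    then show False using W by simp
  qed
  assume d: "1 \<le> d" "d \<le> k"
  have u_pred: "u (k - 1) = v" using u_lt[of "k - 1"] k by simp
  \<comment> \<open>The ends are special: \<open>u k\<close> does not follow the pattern of
    \<open>u_mid\<close>, and \<open>u (2 * k)\<close> is known only after multiplication by
    \<open>s + W\<close>.\<close>
  consider "d = 1" | "1 < d" "d < k" | "d = k" using d by linarith
  then show "(u k - 1) * u (k - 1 + d) \<noteq> (u (k + d) - 1) * u (k - 1)"
  proof cases
    case 1
    have u_Suc: "u (k + 1) - 1 = s * (v + W)"
      using u_mid[of 1] k sv by (simp add: algebra_simps)
    have idx: "k - 1 + d = k" "k + d = k + 1" using 1 k by auto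
    have "(u k - 1) * u (k - 1 + d) - (u (k + d) - 1) * u (k - 1) =
        v * (s + W) * (v * (1 + W)) - s * (v + W) * v"
      unfolding idx uk1 u_Suc u_pred by (simp only: u_k)
    also have "\<dots> = v * W * (v * (1 + s) - s + v * W)"
      by (simp add: algebra_simps)
    finally show ?thesis using W nz by auto
  next
    case 2
    define e where "e = d - 1"
    have e: "1 \<le> e" "e < k" "d = Suc e" using 2 by (auto simp: e_def)
    have u_d: "u (k + d) - 1 = s * u (k + e)"
      using u_mid[of d] u_mid[of e] 2 e sv by (simp add: algebra_simps)
    have idx: "k - 1 + d = k + e" using e k by simp
    have "(u k - 1) * u (k - 1 + d) - (u (k + d) - 1) * u (k - 1) = v * W * u (k + e)"
      unfolding idx uk1 u_d u_pred by (simp add: algebra_simps)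
    also have "\<dots> \<noteq> 0" using W nz u_mid[of e] e by simp
    finally show ?thesis by simp
  next
    case 3
    let ?c = "v + s ^ (k - 1) * W"
    have idx: "k - 1 + d = k + (k - 1)" "k + d = 2 * k" using 3 k by auto
    have u_last: "u (k + (k - 1)) = ?c" using u_mid[of "k - 1"] k by simp
    have "s * s ^ (k - 1) = s ^ k" using k by (simp flip: power_Suc)
    then have u_2k': "(u (2 * k) - 1) * (s + W) = s * s * ?c"
      using u_2k by (simp add: algebra_simps)
    have "((u k - 1) * u (k - 1 + d) - (u (k + d) - 1) * u (k - 1)) * (s + W) =
        v * (s + W) * ?c * (s + W) - v * ((u (2 * k) - 1) * (s + W))"
      unfolding idx uk1 u_pred u_last by (simp add: algebra_simps)
    also have "\<dots> = v * ?c * W * (2 * s + W)"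
      unfolding u_2k' by (simp add: algebra_simps)
    also have "\<dots> \<noteq> 0" using W(1,3) W(6)[of "k - 1"] nz k by simp
    finally show ?thesis by auto
  qed
qed

lemma fixed_point_parameters:
  fixes a :: complex
  assumes "k \<ge> 1" "a ^ k = -1"
  obtains s v where "a = s\<^sup>2" "s \<noteq> 0" "v \<noteq> 0" "v - s * v = 1"
proof -
  obtain s where s: "a = s\<^sup>2" using power2_csqrt by metis
  have "a \<noteq> 1" "a \<noteq> 0" using assms by (auto simp: power_0_left)
  then have s01: "s \<noteq> 0" "1 - s \<noteq> 0" using s by auto
  have "1 / (1 - s) - s * (1 / (1 - s)) = (1 - s) * (1 / (1 - s))"
    by (simp only: left_diff_distrib mult_1)
  also have "\<dots> = 1" using s01 by simp
  finally show ?thesis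
    using s s01 by (intro that[of s "1 / (1 - s)"]) auto
qed

section \<open>Periodicity and least period of the recurrence\<close>

text \<open>The constant orbit at the fixed point \<open>v / a\<close> never meets a zero
  denominator, so this one point certifies all iterates.\<close>

lemma lfr_power_defined:
  assumes k: "k \<ge> 2" and ak: "a ^ k = -1"
  shows "lfr_power k (alpha_coeff k a) (beta_coeff k a) n \<noteq> None"
proof -
  from k ak obtain s v where s: "a = s\<^sup>2" "s \<noteq> 0" "v \<noteq> 0" "v - s * v = 1"
    using fixed_point_parameters[of k a] by auto
  note forms = scaled_affine_forms(1,2)[where h = "\<lambda>x. x" and k = k and a = a,
      OF refl refl refl k ak, of "\<lambda>j. v / a"]
  have a0: "a \<noteq> 0" using s by simp
  have "v \<noteq> 1" using s by auto
  with forms(1) a0 have nz: "affine_form k (beta_coeff k a) (\<lambda>j. v / a) \<noteq> 0" by auto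
  have "a ^ 2 * affine_form k (alpha_coeff k a) (\<lambda>j. v / a) = v * (v - 1)"
    using forms(2) fixed_point_sum[of k s v] k ak s a0 by simp
  also have "\<dots> = v * (a * affine_form k (beta_coeff k a) (\<lambda>j. v / a))"
    using forms(1) a0 by simp
  finally have "v / a = affine_form k (alpha_coeff k a) (\<lambda>j. v / a) /
      affine_form k (beta_coeff k a) (\<lambda>j. v / a)"
    using nz a0 by (simp add: field_simps power2_eq_square)
  then show ?thesis
    using lfr_power_has_value[of k "\<lambda>_. v / a" "\<lambda>_. v / a" n "beta_coeff k a" "alpha_coeff k a"] nz k
    by auto
qed

lemma lfr_periodic_4k:
  assumes k: "k \<ge> 2" and ak: "a ^ k = -1"
  shows "lfr_periodic k (alpha_coeff k a) (beta_coeff k a)"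
  unfolding lfr_periodic_def
proof (intro allI impI)
  fix x assume "lfr_sequence k (alpha_coeff k a) (beta_coeff k a) x"
  then have "\<forall>m\<ge>1. x (m + 4 * k) = x m"
    using scaled_sequence(3)[where h = "\<lambda>x. x" and x = x and k = k and a = a,
        OF refl refl refl k ak] by (simp add: lfr_sequence_def)
  then show "\<exists>p\<ge>1. \<forall>n\<ge>1. x (n + p) = x n" using k by (intro exI[of _ "4 * k"]) simp
qed

lemma lfr_has_period_4k:
  assumes k: "k \<ge> 3" and ak: "a ^ k = -1"
  shows "lfr_has_period k (alpha_coeff k a) (beta_coeff k a) (4 * k)"
proof -
  let ?\<alpha> = "alpha_coeff k a" and ?\<beta> = "beta_coeff k a"
  have k1: "k \<ge> 1" and k2: "k \<ge> 2" using k by auto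
  obtain X where X_var: "\<And>i. 1 \<le> i \<Longrightarrow> i \<le> k \<Longrightarrow> X i = rf_var i"
    and pow: "\<And>n. lfr_power k ?\<alpha> ?\<beta> n = Some (map X [n+1..<n+k+1])"
    and X_nz: "\<And>n. affine_form k (\<lambda>j. rf_const (?\<beta> j)) (\<lambda>j. X (n + j)) \<noteq> 0"
    and X_rec: "\<And>n. X (n + k + 1) = affine_form k (\<lambda>j. rf_const (?\<alpha> j)) (\<lambda>j. X (n + j)) /
            affine_form k (\<lambda>j. rf_const (?\<beta> j)) (\<lambda>j. X (n + j))"
    using universal_sequence[OF k1 lfr_power_defined[OF k2 ak]] by blast
  define U where "U n = rf_const a * X n" for n
  note seq = scaled_sequence[where h = rf_const and x = X, OF rf_const_1 rf_const_mult
      rf_const_diff k2 ak X_nz X_rec, folded U_def]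
  have "rf_const a ^ k = -1"
    by (rule scaled_affine_forms(3)[of rf_const, OF rf_const_1 rf_const_mult rf_const_diff k2 ak])
  then have a0: "rf_const a \<noteq> 0" using k1 by (auto simp: power_0_left)
  note ratio = ratio_relation[OF a0 seq(1,2)]
  define r where "r m = (U (m + 1) - 1) / U m" for m
  have period_iff: "lfr_power k ?\<alpha> ?\<beta> q = Some (rat_id k) \<longleftrightarrow>
      (\<forall>i. 1 \<le> i \<and> i \<le> k \<longrightarrow> X (i + q) = X i)" for q
  proof -
    have "lfr_power k ?\<alpha> ?\<beta> q = Some (rat_id k) \<longleftrightarrow>
        (\<forall>j<k. X (q + 1 + j) = rf_var (1 + j))"
      unfolding pow rat_id_def by (auto simp: list_eq_iff_nth_eq simp del: upt_Suc)
    also have "\<dots> \<longleftrightarrow> (\<forall>i. 1 \<le> i \<and> i \<le> k \<longrightarrow> X (i + q) = X i)"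
    proof safe
      fix i assume "\<forall>j<k. X (q + 1 + j) = rf_var (1 + j)" "1 \<le> i" "i \<le> k"
      then show "X (i + q) = X i" using X_var[of i] by (auto dest!: spec[of _ "i - 1"] simp: add.commute)
    next
      fix j assume "\<forall>i. 1 \<le> i \<and> i \<le> k \<longrightarrow> X (i + q) = X i" "j < k"
      then show "X (q + 1 + j) = rf_var (1 + j)"
        using X_var[of "1 + j"] by (auto dest!: spec[of _ "1 + j"] simp: ac_simps)
    qed
    finally show ?thesis .
  qed
  \<comment> \<open>The recurrence determines every later term from \<open>k\<close> consecutive
    ones, so agreement of the first windows propagates.\<close>
  have extend: "X (m + q) = X m"
    if "\<forall>i. 1 \<le> i \<and> i \<le> k \<longrightarrow> X (i + q) = X i" "m \<ge> 1" for q m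
    using that(2)
  proof (induction m rule: less_induct)
    case (less m)
    show ?case
    proof (cases "m \<le> k")
      case False
      then obtain n where m: "m = n + k + 1" by (metis Suc_eq_plus1 add.commute less_imp_Suc_add
            not_le)
      have "affine_form k c (\<lambda>j. X (n + q + j)) = affine_form k c (\<lambda>j. X (n + j))" for c
      proof (rule affine_form_cong)
        fix j assume "1 \<le> j" "j \<le> k"
        then show "X (n + q + j) = X (n + j)"
          using less.IH[of "n + j"] by (simp add: m ac_simps)
      qed
      then show ?thesis using X_rec[of n] X_rec[of "n + q"] by (simp add: m ac_simps)
    qed (use that less.prems in blast)
  qed
  have no_smaller: "lfr_power k ?\<alpha> ?\<beta> q \<noteq> Some (rat_id k)" if q: "1 \<le> q" "q < 4 * k" for q
  proof
    assume "lfr_power k ?\<alpha> ?\<beta> q = Some (rat_id k)"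
    then have X_per: "X (m + q) = X m" if "m \<ge> 1" for m
      using extend that unfolding period_iff by blast
    obtain s v where s: "a = s\<^sup>2" "s \<noteq> 0" "v \<noteq> 0" "v - s * v = 1"
      using fixed_point_parameters[OF k1 ak] by blast
    obtain W where W: "W \<noteq> 0" "s + W \<noteq> 0" "2 * s + W \<noteq> 0" "v * (1 + s) - s + v * W \<noteq> 0"
      "s * (s ^ k - 1) + s ^ (k + 1) * W \<noteq> 0" "\<And>i. i < k \<Longrightarrow> v + s ^ i * W \<noteq> 0"
      using generic_parameter[OF s(2,3), of k] by blast
    have vW: "v + W \<noteq> 0" using W(6)[of 0] k by simp
    obtain y where y: "\<And>n. n < k + 1 \<Longrightarrow> affine_form k ?\<beta> (\<lambda>j. y (n + j)) \<noteq> 0"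
      "\<And>n. n < k + 1 \<Longrightarrow> y (n + k + 1) =
         affine_form k ?\<alpha> (\<lambda>j. y (n + j)) / affine_form k ?\<beta> (\<lambda>j. y (n + j))"
      and orbit: "\<And>i. 1 \<le> i \<Longrightarrow> i < k \<Longrightarrow> a * y i = v"
      "a * y k = v * (1 + W)"
      "\<And>i. 1 \<le> i \<Longrightarrow> i < k \<Longrightarrow> a * y (k + i) = v + s ^ i * W"
      "(a * y (2 * k) - 1) * (s + W) = s * (s * v + s ^ k * W)"
      "(a * y (2 * k + 1) - 1) * (v + W) = s * v * (a * y (2 * k)) * (1 + W)"
      using special_orbit[OF k ak[unfolded s(1)] s(4) W(2) vW] unfolding s(1)[symmetric] by blast
    note contra = special_orbit_not_periodic[where u = "\<lambda>n. a * y n", OF k s(4,2,3) W orbit]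
    have X_val: "has_value y (X m) (y m)" if m: "1 \<le> m" "m \<le> 2 * k + 1" for m
    proof -
      \<comment> \<open>Truncated subtraction: for \<open>m\<close> up to \<open>k\<close> the value
        is read off the identity, afterwards off the last component of the iterate \<open>N\<close>.
        The bound \<open>2 * k + 1\<close> on \<open>m\<close> matches the denominators controlled
        by \<open>special_orbit\<close>.\<close>
      define N where "N = m - k"
      define j where "j = m - N - 1"
      have N: "N \<le> k + 1" "j < k" "m = N + j + 1" using m k1 by (auto simp: N_def j_def)
      have "\<exists>g. lfr_power k ?\<alpha> ?\<beta> N = Some g \<and> length g = k \<and>
          (\<forall>j<k. has_value y (g ! j) (y (N + j + 1)))"
        by (rule lfr_power_has_value[OF k1 refl]) (use y N in simp_all)
      then have "has_value y (map X [N+1..<N+k+1] ! j) (y (N + j + 1))"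
        using N unfolding pow by (auto simp del: upt_Suc)
      then show ?thesis using N by (simp del: upt_Suc)
    qed
    have U_val: "has_value y (U m) (a * y m)" if "1 \<le> m" "m \<le> 2 * k + 1" for m
      unfolding U_def by (intro has_value_mult has_value_const X_val that)
    have r_2k: "r (m + 2 * k) = r m" if "m \<ge> 1" for m
      using ratio(3)[OF that] by (simp add: r_def)
    have r_q: "r (m + q) = r m" if "m \<ge> 1" for m
      using X_per[of m] X_per[of "m + 1"] that by (simp add: r_def U_def)
    define d where "d = gcd q (2 * k)"
    have r_d: "r (m + d) = r m" if "m \<ge> 1" for m
      using periodic_gcd[of r q "2 * k" m] r_q r_2k q that unfolding d_def by auto
    have "d \<ge> 1" using k1 by (simp add: d_def Suc_leI)
    show False
    \<comment> \<open>As a divisor of \<open>2 * k\<close>, \<open>d\<close> is \<open>2 * k\<close>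
      or at most \<open>k\<close>. In the first case \<open>q\<close> is a multiple of
      \<open>2 * k\<close> below \<open>4 * k\<close>, hence \<open>2 * k\<close> itself.\<close>
    proof (cases "d = 2 * k")
      case True
      then obtain c where "q = 2 * k * c" by (metis d_def gcd_dvd1 dvdE)
      with q have "q = 2 * k" by (cases c; cases "c - 1") auto
      then have "X (2 * k + 1) = X 1" using X_per[of 1] by (simp add: add.commute)
      then have "U (2 * k + 1) = U 1" by (simp add: U_def)
      then show False
        using contra(1) U_val[of "2 * k + 1"] U_val[of 1] has_value_unique k1 by force
    next
      case False
      obtain c where c: "2 * k = d * c" by (metis d_def gcd_dvd2 dvdE)
      have "d \<le> k"
      proof (cases "c \<ge> 2")
        case True
        then have "d * 2 \<le> d * c" by (rule mult_le_mono2)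
        then show ?thesis using c by linarith
      next
        case F: False
        then have "c = 0 \<or> c = 1" by auto
        then show ?thesis using c k1 False by auto
      qed
      \<comment> \<open>Index \<open>k - 1\<close> is the first whose ratio involves the perturbed
        coordinate, through \<open>U k\<close>.\<close>
      have "r (k - 1 + d) = r (k - 1)" by (rule r_d) (use k in simp)
      moreover have "U (k - 1) \<noteq> 0" "U (k - 1 + d) \<noteq> 0"
        by (rule ratio(1); use k in simp)+
      ultimately have eq: "(U k - 1) * U (k - 1 + d) = (U (k + d) - 1) * U (k - 1)"
        using k1 by (simp add: r_def field_simps)
      have "has_value y ((U k - 1) * U (k - 1 + d)) ((a * y k - 1) * (a * y (k - 1 + d)))"
        "has_value y ((U (k + d) - 1) * U (k - 1)) ((a * y (k + d) - 1) * (a * y (k - 1)))"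
        using \<open>d \<ge> 1\<close> \<open>d \<le> k\<close> k
        by (intro has_value_mult has_value_diff has_value_1 U_val; simp)+
      then show False
        using contra(2)[of d] \<open>d \<ge> 1\<close> \<open>d \<le> k\<close> has_value_unique unfolding eq by blast
    qed
  qed
  have "lfr_power k ?\<alpha> ?\<beta> (4 * k) = Some (rat_id k)"
    unfolding period_iff using seq(3) by blast
  with no_smaller k1 show ?thesis
    unfolding lfr_has_period_def by simp
qed

section \<open>Different parameters give different maps\<close>

text \<open>Along a line in direction \<open>x_k\<close> the last component is affine with slope the
  reciprocal of the denominator, which there is \<open>a ^ (k - 1) + t\<close>. The map thus
  determines \<open>a ^ (k - 1)\<close>, and \<open>a ^ k = -1\<close> recovers
  \<open>a\<close>.\<close>

lemma lfr_map_inj_on: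
  assumes k: "k \<ge> 2"
  shows "inj_on (\<lambda>a. lfr_map k (alpha_coeff k a) (beta_coeff k a)) {a. a ^ k = -1}"
proof (rule inj_onI, unfold mem_Collect_eq)
  fix a b :: complex
  assume ak: "a ^ k = -1" and bk: "b ^ k = -1"
    and eq: "lfr_map k (alpha_coeff k a) (beta_coeff k a) =
      lfr_map k (alpha_coeff k b) (beta_coeff k b)"
  have k1: "k \<ge> 1" using k by simp
  have "finite {- (a ^ (k - 1)), - (b ^ (k - 1))}" by simp
  then obtain t where t: "t \<notin> {- (a ^ (k - 1)), - (b ^ (k - 1))}"
    using ex_new_if_finite[OF infinite_UNIV_char_0] by blast
  \<comment> \<open>The first coordinate \<open>t\<close> avoids the zeros of both denominators, and
    the last coordinate \<open>w\<close> enters the numerator with coefficient 1.\<close>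
  define P where "P w i = (if i = 1 then t else if i = k then w else 0)" for w :: complex and i
  have beta: "affine_form k (beta_coeff k c) (P w) = c ^ (k - 1) + t" for c w
  proof -
    have "(\<Sum>j=1..k. beta_coeff k c j * P w j) = (\<Sum>j=1..k. if j = 1 then t else 0)"
      by (intro sum.cong) (auto simp: beta_coeff_def P_def)
    then show ?thesis using k by (simp add: affine_form_def beta_coeff_def)
  qed
  have alpha: "affine_form k (alpha_coeff k c) (P w) = c ^ (k - 2) / (1 - c) + w" for c w
  proof -
    have "(\<Sum>j=1..k. alpha_coeff k c j * P w j) = (\<Sum>j=1..k. if j = k then w else 0)"
      using k by (intro sum.cong) (auto simp: alpha_coeff_def P_def)
    then show ?thesis using k by (simp add: affine_form_def alpha_coeff_def)
  qed
  have map_val: "\<exists>g. lfr_map k (alpha_coeff k c) (beta_coeff k c) = Some g \<and>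
      has_value (P w) (g ! (k - 1)) ((c ^ (k - 2) / (1 - c) + w) / (c ^ (k - 1) + t))"
    if "c \<in> {a, b}" for c w
  proof -
    obtain y where y: "\<And>i. i \<le> k \<Longrightarrow> y i = P w i"
      and rec: "\<And>n. y (n + k + 1) = affine_form k (alpha_coeff k c) (\<lambda>j. y (n + j)) /
        affine_form k (beta_coeff k c) (\<lambda>j. y (n + j))"
      using lfr_orbit_exists by blast
    have form: "affine_form k \<gamma> (\<lambda>j. y (0 + j)) = affine_form k \<gamma> (P w)" for \<gamma>
      by (rule affine_form_cong) (simp add: y)
    have nz: "affine_form k (beta_coeff k c) (\<lambda>j. y (0 + j)) \<noteq> 0"
      unfolding form beta using t that by (auto simp: add_eq_0_iff)
    have "\<exists>g. lfr_power k (alpha_coeff k c) (beta_coeff k c) 1 = Some g \<and> length g = k \<and>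
        (\<forall>j<k. has_value (P w) (g ! j) (y (1 + j + 1)))"
      by (rule lfr_power_has_value[OF k1]) (use y nz rec[of 0] in auto)
    then obtain g where g: "lfr_map k (alpha_coeff k c) (beta_coeff k c) = Some g"
      "\<And>j. j < k \<Longrightarrow> has_value (P w) (g ! j) (y (1 + j + 1))"
      by (auto simp: lfr_map_def)
    moreover have "y (1 + (k - 1) + 1) = (c ^ (k - 2) / (1 - c) + w) / (c ^ (k - 1) + t)"
      using rec[of 0] k1 unfolding form alpha beta by simp
    ultimately show ?thesis using g(2)[of "k - 1"] k1 by simp
  qed
  have "(a ^ (k - 2) / (1 - a) + w) / (a ^ (k - 1) + t) =
      (b ^ (k - 2) / (1 - b) + w) / (b ^ (k - 1) + t)" for w
    using map_val[of a w] map_val[of b w] eq has_value_unique by force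
  \<comment> \<open>Subtracting the values at \<open>w = 0\<close> and \<open>w = 1\<close> isolates
    the slope.\<close>
  from this[of 0] this[of 1] have "1 / (a ^ (k - 1) + t) = 1 / (b ^ (k - 1) + t)"
    by (simp add: add_divide_distrib)
  then have "a ^ (k - 1) = b ^ (k - 1)" by simp
  moreover have "a * a ^ (k - 1) = -1" "b * b ^ (k - 1) = -1"
    using ak bk k1 by (simp_all flip: power_Suc)
  ultimately show "a = b" by (metis mult_cancel_right mult_zero_right neg_equal_0_iff_equal zero_neq_one)
qed

theorem theorem0p1:
  fixes k :: nat
  assumes "k \<ge> 3"
  shows "(\<forall>a::complex. a ^ k = -1 \<longrightarrow>
            lfr_periodic k (alpha_coeff k a) (beta_coeff k a) \<and>
            lfr_has_period k (alpha_coeff k a) (beta_coeff k a) (4 * k)) \<and>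
         card {a::complex. a ^ k = -1} = k \<and>
         inj_on (\<lambda>a. lfr_map k (alpha_coeff k a) (beta_coeff k a)) {a::complex. a ^ k = -1}"
  using assms lfr_periodic_4k lfr_has_period_4k lfr_map_inj_on card_nth_roots[of "-1" k] by auto

end
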